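(* Let $f\colon\mathbb{R}^n\to\mathbb{R}$ be continuously differentiable, let $F\colon\mathbb{R}^n\to\mathbb{R}^\ell$ be directionally differentiable and locally Lipschitz continuous, and let $\Gamma\subseteq\mathbb{R}^\ell$ be nonempty and closed. Let $\bar x\in\mathbb{R}^n$ be a local minimizer of the problem $\min_x f(x)$ s.t. $F(x)\in\Gamma$, and let $d\in\widehat C(\bar x)\cap\mathbb{S}$ be chosen arbitrarily. Then there exists an AM-stationary sequence $\{(x^k,\lambda^k,\delta^k,\varepsilon^k)\}_{k=1}^\infty\subseteq\mathbb{R}^{n+\ell+\ell+n}$ w.r.t. $\bar x$ in direction $d$ such that \[ \frac{\|\delta^k\|\,\|\lambda^k\|}{\|x^k-\bar x\|}\to 0, \] and such that, if additionally MSCQ$(d)$ holds at $\bar x$, then $\{\lambda^k\}_{k=1}^\infty$ is bounded for this particular AM-stationary sequence.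
   Context: Notation. $\|\cdot\|$ is the Euclidean norm, $\mathbb{S}$ the unit sphere of $\mathbb{R}^n$, $\mathbb{B}_\varepsilon(x)$ the closed ball. For a closed set $\Omega\subseteq\mathbb{R}^m$ and $z\in\Omega$: $T_\Omega(z)=\{w : \exists w^k\to w,\ t_k\downarrow 0,\ z+t_kw^k\in\Omega\ \forall k\}$ (tangent cone); $\widehat N_\Omega(z)=\{\eta : \eta^\top w\le 0\ \forall w\in T_\Omega(z)\}$ (regular normal cone); $N_\Omega(z)=\{\eta : \exists z^k\to z,\ z^k\in\Omega,\ \eta^k\to\eta,\ \eta^k\in\widehat N_\Omega(z^k)\ \forall k\}$ (limiting normal cone). All these sets are empty if $z\notin\Omega$. For a locally Lipschitz function $\varphi\colon\mathbb{R}^n\to\mathbb{R}$, $\partial\varphi(x)=\{\xi : (\xi,-1)\in N_{\operatorname{epi}\varphi}((x,\varphi(x)))\}$ is the limiting subdifferential, where $\operatorname{epi}\varphi=\{(x,\alpha):\varphi(x)\le\alpha\}$. For $\lambda\in\mathbb{R}^\ell$, $\langle\lambda,F\rangle(x)=\lambda^\top F(x)$. $F'(x;d)$ is the directional derivative. For sequences $x^k$ (vectors) and $\alpha_k\ge 0$, $x^k\in o(\alpha_k)$ means there is a null sequence $\epsilon_k\ge0$ with $\|x^k\|\le\alpha_k\epsilon_k$ for all $k$ (the $\alpha_k$ may vanish). Feasible set: $X=F^{-1}(\Gamma)=\{x : F(x)\in\Gamma\}$. Implicit critical cone: $\widehat C(\bar x)=\{d\in\mathbb{R}^n : f'(\bar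 x)d\le 0,\ d\in T_X(\bar x)\}$. Linearization cone: $T^{\rm lin}_{F,\Gamma}(\bar x)=\{d : F'(\bar x;d)\in T_\Gamma(F(\bar x))\}$ (it contains $T_X(\bar x)$). AM-stationary sequence w.r.t. a feasible point $\bar x$: a sequence $\{(x^k,\lambda^k,\delta^k,\varepsilon^k)\}\subseteq\mathbb{R}^{n+\ell+\ell+n}$ with $\varepsilon^k-\nabla f(x^k)\in\partial\langle\lambda^k,F\rangle(x^k)$ and $\lambda^k\in N_\Gamma(F(x^k)-\delta^k)$ for all $k$, and $(x^k,\delta^k,\varepsilon^k)\to(\bar x,0,0)$. For $d\in T^{\rm lin}_{F,\Gamma}(\bar x)\cap\mathbb{S}$, such a sequence is AM-stationary w.r.t. $\bar x$ in direction $d$ if additionally $x^k\ne\bar x$ for all $k$, $(x^k-\bar x)/\|x^k-\bar x\|\to d$, $\delta^k/\|x^k-\bar x\|\to 0$, $\|\delta^k\|\lambda^k-\|\lambda^k\|\delta^k\in o(\|\delta^k\|\|\lambda^k\|)$, and $\{\|\delta^k\|\|\lambda^k\|/\|x^k-\bar x\|\}_k$ is bounded. MSCQ$(d)$ at a feasible point $\bar x$: there are $\varepsilon,\delta,\kappa>0$ such that $\operatorname{dist}(x,F^{-1}(\Gamma))\le\kappa\operatorname{dist}(F(x),\Gamma)$ for all $x\in\{\bar x\}+\mathbb{B}_{\varepsilon,\delta}(d)$, where $\mathbb{B}_{\varepsilon,\delta}(d)=\{y\in\mathbb{B}_\varepsilon(0) : \big\|\,\|d\|y-\|y\|d\,\big\|\le\delta\|y\|\|d\|\}$.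 *)

theory Defs
  imports "HOL-Analysis.Analysis"
begin

section \<open>Tangent cones, normal cones and the limiting subdifferential\<close>

text \<open>The conjunct \<open>z \<in> \<Omega>\<close> encodes the convention that these cones are empty at
  points outside \<open>\<Omega>\<close>.\<close>

definition tangent_cone :: "'a::real_normed_vector set \<Rightarrow> 'a \<Rightarrow> 'a set" where
  "tangent_cone \<Omega> z =
     {w. z \<in> \<Omega> \<and>
         (\<exists>W t. W \<longlonglongrightarrow> w \<and> (\<forall>k::nat. 0 < t k) \<and> t \<longlonglongrightarrow> (0::real) \<and>
                (\<forall>k. z + t k *\<^sub>R W k \<in> \<Omega>))}"

definition regular_normal_cone :: "'a::real_inner set \<Rightarrow> 'a \<Rightarrow> 'a set" where
  "regular_normal_cone \<Omega> z = {\<eta>. z \<in> \<Omega> \<and> (\<forall>w\<in>tangent_cone \<Omega> z. \<eta> \<bullet> w \<le> 0)}"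

definition limiting_normal_cone :: "'a::real_inner set \<Rightarrow> 'a \<Rightarrow> 'a set" where
  "limiting_normal_cone \<Omega> z =
     {\<eta>. z \<in> \<Omega> \<and>
         (\<exists>Z H. Z \<longlonglongrightarrow> z \<and> (\<forall>k::nat. Z k \<in> \<Omega>) \<and> H \<longlonglongrightarrow> \<eta> \<and>
                (\<forall>k. H k \<in> regular_normal_cone \<Omega> (Z k)))}"

definition limiting_subdifferential :: "('a::real_inner \<Rightarrow> real) \<Rightarrow> 'a \<Rightarrow> 'a set" where
  "limiting_subdifferential \<phi> x =
     {\<xi>. (\<xi>, -1) \<in> limiting_normal_cone (epigraph UNIV \<phi>) (x, \<phi> x)}"

section \<open>Smoothness notions\<close>

definition gradient :: "('a::real_inner \<Rightarrow> real) \<Rightarrow> 'a \<Rightarrow> 'a" where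
  "gradient f x = (THE v. GDERIV f x :> v)"

definition continuously_differentiable :: "('a::euclidean_space \<Rightarrow> real) \<Rightarrow> bool" where
  "continuously_differentiable f \<longleftrightarrow>
     (\<forall>x. f differentiable (at x)) \<and> continuous_on UNIV (gradient f)"

definition directionally_differentiable ::
    "('a::real_normed_vector \<Rightarrow> 'b::real_normed_vector) \<Rightarrow> bool" where
  "directionally_differentiable F \<longleftrightarrow>
     (\<forall>x d. \<exists>l. ((\<lambda>t. (F (x + t *\<^sub>R d) - F x) /\<^sub>R t) \<longlongrightarrow> l) (at_right 0))"

definition directional_derivative ::
    "('a::real_normed_vector \<Rightarrow> 'b::real_normed_vector) \<Rightarrow> 'a \<Rightarrow> 'a \<Rightarrow> 'b" where
  "directional_derivative F x d = Lim (at_right 0) (\<lambda>t. (F (x + t *\<^sub>R d) - F x) /\<^sub>R t)"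

definition locally_lipschitz :: "('a::metric_space \<Rightarrow> 'b::metric_space) \<Rightarrow> bool" where
  "locally_lipschitz F \<longleftrightarrow> (\<forall>x. \<exists>r>0. \<exists>L. L-lipschitz_on (cball x r) F)"

section \<open>The problem of minimizing \<open>f x\<close> subject to \<open>F x \<in> \<Gamma>\<close>\<close>

definition local_minimizer ::
    "('a::metric_space \<Rightarrow> real) \<Rightarrow> ('a \<Rightarrow> 'b) \<Rightarrow> 'b set \<Rightarrow> 'a \<Rightarrow> bool" where
  "local_minimizer f F \<Gamma> xbar \<longleftrightarrow>
     F xbar \<in> \<Gamma> \<and> (\<exists>r>0. \<forall>x\<in>cball xbar r. F x \<in> \<Gamma> \<longrightarrow> f xbar \<le> f x)"

definition implicit_critical_cone ::
    "('a::real_normed_vector \<Rightarrow> real) \<Rightarrow> ('a \<Rightarrow> 'b) \<Rightarrow> 'b set \<Rightarrow> 'a \<Rightarrow> 'a set" where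
  "implicit_critical_cone f F \<Gamma> xbar =
     {d. frechet_derivative f (at xbar) d \<le> 0 \<and> d \<in> tangent_cone (F -` \<Gamma>) xbar}"

definition linearization_cone ::
    "('a::real_normed_vector \<Rightarrow> 'b::real_normed_vector) \<Rightarrow> 'b set \<Rightarrow> 'a \<Rightarrow> 'a set" where
  "linearization_cone F \<Gamma> xbar =
     {d. directional_derivative F xbar d \<in> tangent_cone \<Gamma> (F xbar)}"

section \<open>AM-stationary sequences\<close>

text \<open>The bound is a product, not a quotient, since \<open>\<alpha> k\<close> may vanish.\<close>

definition seq_little_o :: "(nat \<Rightarrow> 'a::real_normed_vector) \<Rightarrow> (nat \<Rightarrow> real) \<Rightarrow> bool" where
  "seq_little_o v \<alpha> \<longleftrightarrow>
     (\<exists>\<epsilon>. (\<forall>k. 0 \<le> \<epsilon> k) \<and> \<epsilon> \<longlonglongrightarrow> 0 \<and> (\<forall>k. norm (v k) \<le> \<alpha> k * \<epsilon> k))"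

definition AM_stationary_seq ::
    "('a::real_inner \<Rightarrow> real) \<Rightarrow> ('a \<Rightarrow> 'b::real_inner) \<Rightarrow> 'b set \<Rightarrow> 'a \<Rightarrow>
     (nat \<Rightarrow> 'a) \<Rightarrow> (nat \<Rightarrow> 'b) \<Rightarrow> (nat \<Rightarrow> 'b) \<Rightarrow> (nat \<Rightarrow> 'a) \<Rightarrow> bool" where
  "AM_stationary_seq f F \<Gamma> xbar x lam \<delta> \<epsilon> \<longleftrightarrow>
     F xbar \<in> \<Gamma> \<and>
     (\<forall>k. \<epsilon> k - gradient f (x k) \<in> limiting_subdifferential (\<lambda>y. lam k \<bullet> F y) (x k)) \<and>
     (\<forall>k. lam k \<in> limiting_normal_cone \<Gamma> (F (x k) - \<delta> k)) \<and>
     x \<longlonglongrightarrow> xbar \<and> \<delta> \<longlonglongrightarrow> 0 \<and> \<epsilon> \<longlonglongrightarrow> 0"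

definition AM_stationary_seq_dir ::
    "('a::real_inner \<Rightarrow> real) \<Rightarrow> ('a \<Rightarrow> 'b::real_inner) \<Rightarrow> 'b set \<Rightarrow> 'a \<Rightarrow> 'a \<Rightarrow>
     (nat \<Rightarrow> 'a) \<Rightarrow> (nat \<Rightarrow> 'b) \<Rightarrow> (nat \<Rightarrow> 'b) \<Rightarrow> (nat \<Rightarrow> 'a) \<Rightarrow> bool" where
  "AM_stationary_seq_dir f F \<Gamma> xbar d x lam \<delta> \<epsilon> \<longleftrightarrow>
     d \<in> linearization_cone F \<Gamma> xbar \<inter> sphere 0 1 \<and>
     AM_stationary_seq f F \<Gamma> xbar x lam \<delta> \<epsilon> \<and>
     (\<forall>k. x k \<noteq> xbar) \<and>
     (\<lambda>k. (x k - xbar) /\<^sub>R norm (x k - xbar)) \<longlonglongrightarrow> d \<and>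
     (\<lambda>k. \<delta> k /\<^sub>R norm (x k - xbar)) \<longlonglongrightarrow> 0 \<and>
     seq_little_o (\<lambda>k. norm (\<delta> k) *\<^sub>R lam k - norm (lam k) *\<^sub>R \<delta> k)
                  (\<lambda>k. norm (\<delta> k) * norm (lam k)) \<and>
     bounded (range (\<lambda>k. norm (\<delta> k) * norm (lam k) / norm (x k - xbar)))"

section \<open>Directional metric subregularity\<close>

definition directional_nbhd :: "real \<Rightarrow> real \<Rightarrow> 'a::real_normed_vector \<Rightarrow> 'a set" where
  "directional_nbhd \<epsilon> \<delta> d =
     {y \<in> cball 0 \<epsilon>. norm (norm d *\<^sub>R y - norm y *\<^sub>R d) \<le> \<delta> * norm y * norm d}"

text \<open>To be used only with \<open>F xbar \<in> \<Gamma>\<close>: then both sets below are nonempty, so the library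
  convention \<open>infdist x {} = 0\<close> plays no role.\<close>

definition MSCQ_dir ::
    "('a::real_normed_vector \<Rightarrow> 'b::metric_space) \<Rightarrow> 'b set \<Rightarrow> 'a \<Rightarrow> 'a \<Rightarrow> bool" where
  "MSCQ_dir F \<Gamma> xbar d \<longleftrightarrow>
     (\<exists>\<epsilon>>0. \<exists>\<delta>>0. \<exists>\<kappa>>0. \<forall>x \<in> (+) xbar ` directional_nbhd \<epsilon> \<delta> d.
        infdist x (F -` \<Gamma>) \<le> \<kappa> * infdist (F x) \<Gamma>)"

end

theory Submission
  imports Defs
begin

text \<open>Let \<open>y k = xbar + t k *\<^sub>R W k\<close> be feasible points realizing the tangent direction \<open>d\<close>.
  Since \<open>xbar\<close> is a local minimizer and \<open>f'(xbar) d \<le> 0\<close>, we have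
  \<open>f (y k) - f xbar < t k * e k\<close> with \<open>e k\<close> tending to zero. Near \<open>xbar\<close> one minimizes
  \<open>f x + m/2 * |F x - u|\<^sup>2 + c/2 * |x - y k|\<^sup>2\<close> over \<open>x\<close> and \<open>u \<in> \<Gamma>\<close>, with
  \<open>c = sqrt (e k) / t k\<close> and \<open>m\<close> large depending on \<open>k\<close>. Then \<open>m * |F x - u|\<^sup>2\<close> and
  \<open>c * |x - y k|\<^sup>2\<close> are at most \<open>2 * t k * e k\<close>, and \<open>\<delta> = F x - u\<close>, \<open>\<lambda> = m \<delta>\<close>,
  \<open>\<epsilon> = - c (x - y k)\<close> are the required sequences. Under directional metric subregularity there is
  a feasible point within \<open>\<kappa> * |\<delta>|\<close> of \<open>x\<close>; comparing the penalized objective there bounds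
  \<open>m * |\<delta>| = |\<lambda>|\<close>.\<close>

section \<open>Differentiable functions: difference quotients, gradients, Lipschitz bounds\<close>

text \<open>Tangent cones involve directions \<open>W k\<close> that vary with \<open>k\<close>. The
  quotient splits into \<open>D (W k)\<close> plus \<open>norm (W k)\<close> times the normalized
  remainder \<open>\<rho>\<close> at \<open>t k *\<^sub>R W k\<close>, which tends to zero.\<close>

lemma has_derivative_imp_hadamard:
  fixes g :: "'a::real_normed_vector \<Rightarrow> 'b::real_normed_vector"
  assumes g: "(g has_derivative D) (at x)"
    and W: "W \<longlonglongrightarrow> w" and t: "\<And>k. 0 < t k" "t \<longlonglongrightarrow> (0::real)"
  shows "(\<lambda>k. (g (x + t k *\<^sub>R W k) - g x) /\<^sub>R t k) \<longlonglongrightarrow> D w"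
proof -
  define \<rho> where "\<rho> h = (g (x + h) - g x - D h) /\<^sub>R norm h" for h
  have bl: "bounded_linear D"
    using g has_derivative_bounded_linear by blast
  have "((\<lambda>h. norm (\<rho> h)) \<longlongrightarrow> 0) (at 0)"
    using g unfolding has_derivative_at \<rho>_def by (simp add: divide_inverse mult.commute)
  \<comment> \<open>Since \<open>inverse 0 = 0\<close>, \<open>\<rho> 0\<close> is zero; the
    punctured limit thus becomes continuity, which also covers indices with
    \<open>W k = 0\<close>.\<close>
  then have "isCont \<rho> 0"
    unfolding isCont_def by (auto dest: tendsto_norm_zero_cancel simp: \<rho>_def[of 0])
  moreover have "(\<lambda>k. t k *\<^sub>R W k) \<longlonglongrightarrow> 0"
    using tendsto_scaleR[OF t(2) W] by simp
  ultimately have "(\<lambda>k. \<rho> (t k *\<^sub>R W k)) \<longlonglongrightarrow> \<rho> 0"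
    by (rule isCont_tendsto_compose)
  then have "(\<lambda>k. norm (W k) *\<^sub>R \<rho> (t k *\<^sub>R W k) + D (W k)) \<longlonglongrightarrow> norm w *\<^sub>R \<rho> 0 + D w"
    by (intro tendsto_intros W bounded_linear.tendsto[OF bl])
  moreover have "norm (W k) *\<^sub>R \<rho> (t k *\<^sub>R W k) + D (W k) = (g (x + t k *\<^sub>R W k) - g x) /\<^sub>R t k" for k
  proof (cases "W k = 0")
    case True
    then show ?thesis by (simp add: bounded_linear.linear[OF bl] linear_0)
  next
    case False
    have "norm (W k) *\<^sub>R \<rho> (t k *\<^sub>R W k) = (g (x + t k *\<^sub>R W k) - g x - t k *\<^sub>R D (W k)) /\<^sub>R t k"
      using False t(1)[of k]
      by (simp add: \<rho>_def linear_scale[OF bounded_linear.linear[OF bl]] less_imp_le)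
    then show ?thesis
      using t(1)[of k] by (simp add: scaleR_diff_right)
  qed
  ultimately show ?thesis
    by (simp add: \<rho>_def)
qed

text \<open>As \<open>gradient\<close> is a definite description, both a candidate and uniqueness
  are required. The candidate is the Riesz representative \<open>adjoint D 1\<close>.\<close>

lemma gderiv_gradient:
  fixes f :: "'a::euclidean_space \<Rightarrow> real"
  assumes "f differentiable (at x)"
  shows "GDERIV f x :> gradient f x"
proof -
  obtain D where D: "(f has_derivative D) (at x)"
    using assms by (auto simp: differentiable_def)
  have "D = (\<lambda>h. h \<bullet> adjoint D 1)"
    using adjoint_works[OF has_derivative_linear[OF D]] by (auto simp: fun_eq_iff)
  then have "GDERIV f x :> adjoint D 1"
    using D by (simp add: gderiv_def)
  moreover have "v = w" if "GDERIV f x :> v" "GDERIV f x :> w" for v w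
  proof -
    have "(\<lambda>h. h \<bullet> v) = (\<lambda>h. h \<bullet> w)"
      using that has_derivative_unique unfolding gderiv_def by blast
    then show ?thesis
      by (metis vector_eq_ldot)
  qed
  ultimately show ?thesis
    unfolding gradient_def by (metis theI)
qed

text \<open>Supplies the constant \<open>M\<close> of the multiplier bound: compactness bounds the
  gradient, convexity admits the mean value inequality.\<close>

lemma continuously_differentiable_lipschitz_on:
  fixes f :: "'a::euclidean_space \<Rightarrow> real"
  assumes f: "continuously_differentiable f" and "compact B" "convex B"
  obtains L where "L-lipschitz_on B f"
proof -
  have "bounded (gradient f ` B)"
    using assms compact_continuous_image[of B "gradient f"] continuous_on_subset
    unfolding continuously_differentiable_def by (blast intro: compact_imp_bounded)
  then obtain L where L: "0 < L" "\<And>x. x \<in> B \<Longrightarrow> norm (gradient f x) \<le> L"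
    by (auto simp: bounded_pos)
  have "norm (f x - f y) \<le> L * norm (x - y)" if "x \<in> B" "y \<in> B" for x y
  proof (rule differentiable_bound[OF \<open>convex B\<close> _ _ that])
    show "(f has_derivative (\<lambda>h. h \<bullet> gradient f z)) (at z within B)" for z
      using f gderiv_gradient[of f z] has_derivative_at_withinI
      unfolding continuously_differentiable_def gderiv_def by blast
    show "onorm (\<lambda>h. h \<bullet> gradient f z) \<le> L" if "z \<in> B" for z
    proof (rule onorm_bound)
      fix h
      show "norm (h \<bullet> gradient f z) \<le> L * norm h"
        using Cauchy_Schwarz_ineq2[of h "gradient f z"] mult_left_mono[OF L(2)[OF that], of "norm h"]
        by (simp add: mult.commute)
    qed (use L(1) in simp)
  qed
  then have "L-lipschitz_on B f"
    using L(1) by (intro lipschitz_onI) (auto simp: dist_norm)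
  then show thesis ..
qed

section \<open>Normals, subgradients and tangents\<close>

lemma regular_normal_cone_imp_limiting:
  "\<eta> \<in> regular_normal_cone \<Omega> z \<Longrightarrow> \<eta> \<in> limiting_normal_cone \<Omega> z"
  unfolding limiting_normal_cone_def regular_normal_cone_def
  using tendsto_const by blast

text \<open>The vector \<open>p - u\<close> is a proximal normal: expanding the squared distance
  along a tangent sequence and dividing by \<open>t k\<close> leaves only
  \<open>t k * (W k \<bullet> W k)\<close>, which vanishes in the limit.\<close>

lemma projection_normal:
  fixes p u :: "'a::real_inner"
  assumes "u \<in> \<Omega>" and min: "\<And>v. v \<in> \<Omega> \<Longrightarrow> dist p u \<le> dist p v" and "0 \<le> m"
  shows "m *\<^sub>R (p - u) \<in> limiting_normal_cone \<Omega> u"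
proof (rule regular_normal_cone_imp_limiting)
  have "(p - u) \<bullet> w \<le> 0" if "w \<in> tangent_cone \<Omega> u" for w
  proof -
    obtain W t where W: "W \<longlonglongrightarrow> w" and t: "\<And>k::nat. 0 < t k" "t \<longlonglongrightarrow> (0::real)"
      and in\<Omega>: "\<And>k. u + t k *\<^sub>R W k \<in> \<Omega>"
      using \<open>w \<in> tangent_cone \<Omega> u\<close> unfolding tangent_cone_def by blast
    have "2 * ((p - u) \<bullet> W k) \<le> t k * (W k \<bullet> W k)" for k
    proof -
      have "(norm (p - u))\<^sup>2 \<le> (norm ((p - u) - t k *\<^sub>R W k))\<^sup>2"
        using min[OF in\<Omega>[of k]] by (intro power_mono) (simp_all add: dist_norm diff_diff_eq)
      then have "t k * (2 * ((p - u) \<bullet> W k)) \<le> t k * (t k * (W k \<bullet> W k))"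
        by (simp add: power2_norm_eq_inner inner_diff_left inner_diff_right inner_commute
            algebra_simps)
      then show ?thesis
        using t(1)[of k] by simp
    qed
    moreover have "(\<lambda>k. 2 * ((p - u) \<bullet> W k)) \<longlonglongrightarrow> 2 * ((p - u) \<bullet> w)"
      by (intro tendsto_intros W)
    moreover have "(\<lambda>k. t k * (W k \<bullet> W k)) \<longlonglongrightarrow> 0 * (w \<bullet> w)"
      by (intro tendsto_intros W t)
    ultimately have "2 * ((p - u) \<bullet> w) \<le> 0 * (w \<bullet> w)"
      using LIMSEQ_le by blast
    then show ?thesis by simp
  qed
  then show "m *\<^sub>R (p - u) \<in> regular_normal_cone \<Omega> u"
    using assms(1,3) by (auto simp: regular_normal_cone_def mult_nonneg_nonpos)
qed

text \<open>Along a tangent sequence of the epigraph, the increment of \<open>\<phi>\<close> is at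
  most \<open>t k * snd (W k)\<close>, while minimality makes the increment of
  \<open>\<phi> + g\<close> nonnegative. Dividing by \<open>t k\<close> and using differentiability
  of \<open>g\<close> gives \<open>0 \<le> fst w \<bullet> v + snd w\<close>, so
  \<open>(- v, -1)\<close> is even a regular normal.\<close>

lemma limiting_subdifferential_of_local_min:
  fixes \<phi> g :: "'a::real_inner \<Rightarrow> real"
  assumes g: "GDERIV g x :> v"
    and min: "\<forall>\<^sub>F z in nhds x. \<phi> x + g x \<le> \<phi> z + g z"
  shows "- v \<in> limiting_subdifferential \<phi> x"
proof -
  let ?E = "epigraph UNIV \<phi>"
  have "(- v, -1) \<bullet> w \<le> 0" if w: "w \<in> tangent_cone ?E (x, \<phi> x)" for w
  proof -
    obtain W t where W: "W \<longlonglongrightarrow> w" and t: "\<And>k::nat. 0 < t k" "t \<longlonglongrightarrow> (0::real)"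
      and inE: "\<And>k. (x, \<phi> x) + t k *\<^sub>R W k \<in> ?E"
      using w unfolding tangent_cone_def by blast
    have W1: "(\<lambda>k. fst (W k)) \<longlonglongrightarrow> fst w" and W2: "(\<lambda>k. snd (W k)) \<longlonglongrightarrow> snd w"
      using W by (auto intro: tendsto_fst tendsto_snd)
    have epi: "\<phi> (x + t k *\<^sub>R fst (W k)) \<le> \<phi> x + t k * snd (W k)" for k
      using inE[of k] by (simp add: mem_epigraph plus_prod_def scaleR_prod_def)
    have "(\<lambda>k. x + t k *\<^sub>R fst (W k)) \<longlonglongrightarrow> x + 0 *\<^sub>R fst w"
      by (intro tendsto_intros t W1)
    then have "\<forall>\<^sub>F k in sequentially. \<phi> x + g x \<le> \<phi> (x + t k *\<^sub>R fst (W k)) + g (x + t k *\<^sub>R fst (W k))"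
      using min by (auto simp: filterlim_iff)
    then have "\<forall>\<^sub>F k in sequentially. 0 \<le> (g (x + t k *\<^sub>R fst (W k)) - g x) /\<^sub>R t k + snd (W k)"
    proof eventually_elim
      case (elim k)
      then have "0 \<le> (g (x + t k *\<^sub>R fst (W k)) - g x) + t k * snd (W k)"
        using epi[of k] by linarith
      also have "\<dots> = t k * ((g (x + t k *\<^sub>R fst (W k)) - g x) /\<^sub>R t k + snd (W k))"
        using t(1)[of k] by (simp add: distrib_left)
      finally show ?case
        using t(1)[of k] by (simp add: zero_le_mult_iff)
    qed
    moreover have "(\<lambda>k. (g (x + t k *\<^sub>R fst (W k)) - g x) /\<^sub>R t k + snd (W k))
        \<longlonglongrightarrow> fst w \<bullet> v + snd w"
      using g unfolding gderiv_def
      by (intro tendsto_add W2 has_derivative_imp_hadamard[of g "\<lambda>h. h \<bullet> v", OF _ W1 t])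
    ultimately have "0 \<le> fst w \<bullet> v + snd w"
      by (intro tendsto_lowerbound) auto
    then show ?thesis
      by (simp add: inner_prod_def inner_commute)
  qed
  then have "(- v, -1) \<in> regular_normal_cone ?E (x, \<phi> x)"
    by (auto simp: regular_normal_cone_def mem_epigraph)
  then show ?thesis
    by (simp add: limiting_subdifferential_def regular_normal_cone_imp_limiting)
qed

text \<open>Replacing \<open>W k\<close> by the fixed direction \<open>d\<close> changes the
  difference quotient of \<open>F\<close> by at most \<open>L * norm (W k - d)\<close>. The
  quotients \<open>V k\<close> therefore converge to the directional derivative and witness its
  tangency to \<open>\<Gamma>\<close>.\<close>

lemma tangent_cone_subset_linearization_cone:
  fixes F :: "'a::real_normed_vector \<Rightarrow> 'b::real_normed_vector"
  assumes dd: "directionally_differentiable F" and lip: "locally_lipschitz F"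
  shows "tangent_cone (F -` \<Gamma>) x \<subseteq> linearization_cone F \<Gamma> x"
proof
  fix d assume "d \<in> tangent_cone (F -` \<Gamma>) x"
  then obtain W t where Fx: "F x \<in> \<Gamma>" and W: "W \<longlonglongrightarrow> d"
    and t: "\<And>k::nat. 0 < t k" "t \<longlonglongrightarrow> (0::real)" and in\<Gamma>: "\<And>k. F (x + t k *\<^sub>R W k) \<in> \<Gamma>"
    unfolding tangent_cone_def by auto
  obtain r L where r: "r > 0" "L-lipschitz_on (cball x r) F"
    using lip unfolding locally_lipschitz_def by blast
  let ?q = "\<lambda>t. (F (x + t *\<^sub>R d) - F x) /\<^sub>R t"
  define l where "l = directional_derivative F x d"
  obtain l' where l': "(?q \<longlongrightarrow> l') (at_right 0)"
    using dd unfolding directionally_differentiable_def by blast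
  then have "l = l'"
    unfolding l_def directional_derivative_def by (intro tendsto_Lim) auto
  moreover have "filterlim t (at_right 0) sequentially"
    using t by (intro tendsto_imp_filterlim_at_right) auto
  ultimately have ql: "(\<lambda>k. ?q (t k)) \<longlonglongrightarrow> l"
    using l' filterlim_compose by blast
  define V where "V k = (F (x + t k *\<^sub>R W k) - F x) /\<^sub>R t k" for k
  have inball: "\<forall>\<^sub>F k in sequentially. x + t k *\<^sub>R U k \<in> cball x r" if "U \<longlonglongrightarrow> d" for U
  proof -
    have "(\<lambda>k. x + t k *\<^sub>R U k) \<longlonglongrightarrow> x + 0 *\<^sub>R d"
      by (intro tendsto_intros t that)
    then have "\<forall>\<^sub>F k in sequentially. dist (x + t k *\<^sub>R U k) x < r"
      using r(1) by (auto dest: tendstoD)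
    then show ?thesis
      by eventually_elim (simp add: dist_commute)
  qed
  have "\<forall>\<^sub>F k in sequentially. norm (V k - ?q (t k)) \<le> L * norm (W k - d)"
    using inball[OF W] inball[OF tendsto_const]
  proof eventually_elim
    case (elim k)
    have "norm (V k - ?q (t k)) = norm (F (x + t k *\<^sub>R W k) - F (x + t k *\<^sub>R d)) / t k"
      using t(1)[of k] by (simp add: V_def divide_inverse flip: scaleR_diff_right)
    also have "\<dots> \<le> (L * norm ((x + t k *\<^sub>R W k) - (x + t k *\<^sub>R d))) / t k"
      using lipschitz_onD[OF r(2) elim] t(1)[of k] by (intro divide_right_mono) (auto simp: dist_norm)
    also have "\<dots> = L * norm (W k - d)"
      using t(1)[of k] by (simp flip: scaleR_diff_right)
    finally show ?case .
  qed
  moreover have "(\<lambda>k. L * norm (W k - d)) \<longlonglongrightarrow> 0"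
    using tendsto_mult[OF tendsto_const[of L] tendsto_norm_zero[OF LIM_zero[OF W]]] by simp
  ultimately have "(\<lambda>k. V k - ?q (t k)) \<longlonglongrightarrow> 0"
    by (rule Lim_null_comparison)
  from tendsto_add[OF this ql] have "V \<longlonglongrightarrow> l"
    by simp
  moreover have "F x + t k *\<^sub>R V k \<in> \<Gamma>" for k
    using in\<Gamma>[of k] t(1)[of k] by (simp add: V_def)
  ultimately show "d \<in> linearization_cone F \<Gamma> x"
    using Fx t unfolding linearization_cone_def tangent_cone_def l_def by blast
qed

section \<open>The penalized problem\<close>

text \<open>The variable \<open>u\<close> is eliminated through \<open>infdist\<close>, so
  minimization runs over the compact set \<open>B\<close>, and \<open>u\<close> is recovered as a
  nearest point. Comparison with \<open>y\<close> bounds \<open>f x\<close> plus both penalties by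
  \<open>f y\<close>; once \<open>f x\<close> exceeds \<open>f y - e\<close>, each penalty is below
  \<open>e\<close>.\<close>

lemma penalty_minimizer:
  fixes f :: "'a::real_normed_vector \<Rightarrow> real" and F :: "'a \<Rightarrow> 'b::euclidean_space"
  assumes B: "compact B" and f: "continuous_on B f" and F: "continuous_on B F"
    and \<Gamma>: "closed \<Gamma>" and y: "y \<in> B" "F y \<in> \<Gamma>"
    and low: "\<And>z. z \<in> B \<Longrightarrow> F z \<in> \<Gamma> \<Longrightarrow> f y - e < f z" and "0 < c" "0 < \<eta>"
  obtains m x u where "0 < m" "x \<in> B" "u \<in> \<Gamma>"
    "\<forall>z\<in>B. \<forall>v\<in>\<Gamma>.
      f x + m / 2 * (dist (F x) u)\<^sup>2 + c / 2 * (dist x y)\<^sup>2 \<le>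
      f z + m / 2 * (dist (F z) v)\<^sup>2 + c / 2 * (dist z y)\<^sup>2"
    "dist (F x) u \<le> \<eta>" "m * (dist (F x) u)\<^sup>2 \<le> 2 * e" "c * (dist x y)\<^sup>2 \<le> 2 * e"
proof -
  have \<Gamma>ne: "\<Gamma> \<noteq> {}" using y by auto
  have ci: "continuous_on B (\<lambda>z. infdist (F z) \<Gamma>)"
    by (intro continuous_intros F)
  obtain lo where lo: "\<And>z. z \<in> B \<Longrightarrow> lo \<le> f z"
    using continuous_attains_inf[OF B _ f] y by blast
  text \<open>On the compact set where \<open>f\<close> falls below \<open>f y - e\<close> the infeasibility is bounded away
    from zero, so a large penalty parameter pushes the minimizer out of it.\<close>
  define S where "S = B \<inter> f -` {..f y - e}"
  have "compact S"
    using compact_Int_closed[OF B continuous_closed_preimage[OF f compact_imp_closed[OF B] closed_atMost]]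
    by (simp add: S_def Int_assoc[symmetric])
  obtain \<rho> where \<rho>: "0 < \<rho>" "\<And>z. z \<in> S \<Longrightarrow> \<rho> \<le> infdist (F z) \<Gamma>"
  proof (cases "S = {}")
    case True
    then show thesis using that[of 1] by simp
  next
    case False
    then obtain z where z: "z \<in> S" "\<And>z'. z' \<in> S \<Longrightarrow> infdist (F z) \<Gamma> \<le> infdist (F z') \<Gamma>"
      using continuous_attains_inf[OF \<open>compact S\<close> False continuous_on_subset[OF ci]]
      unfolding S_def by auto
    have "F z \<notin> \<Gamma>"
      using z(1) low[of z] by (auto simp: S_def)
    then have "0 < infdist (F z) \<Gamma>"
      using in_closed_iff_infdist_zero[OF \<Gamma> \<Gamma>ne] infdist_nonneg[of "F z" \<Gamma>] by (metis less_le)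
    then show thesis using that z by blast
  qed
  define q where "q = min (\<rho> / 2) \<eta>"
  have q: "0 < q" "q < \<rho>" "q \<le> \<eta>"
    using \<rho> \<open>0 < \<eta>\<close> by (auto simp: q_def)
  \<comment> \<open>Chosen so that infeasibility \<open>q\<close> would cost
    \<open>f y - lo + 1\<close>, more than a minimizer can afford. The summand 1 makes this strict
    and \<open>m\<close> positive.\<close>
  define m where "m = 2 * (f y - lo + 1) / q\<^sup>2"
  have m: "0 < m"
    using lo[OF y(1)] q by (simp add: m_def)
  define h where "h z = f z + m / 2 * (infdist (F z) \<Gamma>)\<^sup>2 + c / 2 * (dist z y)\<^sup>2" for z
  have "continuous_on B h"
    unfolding h_def by (intro continuous_intros f F)
  then obtain x where x: "x \<in> B" "\<And>z. z \<in> B \<Longrightarrow> h x \<le> h z"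
    using continuous_attains_inf[OF B] y by blast
  obtain u where u: "u \<in> \<Gamma>" "infdist (F x) \<Gamma> = dist (F x) u"
    using infdist_attains_inf[OF \<Gamma> \<Gamma>ne] by blast
  have "h y = f y" using y by (simp add: h_def)
  then have hx: "f x + m / 2 * (dist (F x) u)\<^sup>2 + c / 2 * (dist x y)\<^sup>2 \<le> f y"
    using x(2)[OF y(1)] u(2) by (simp add: h_def[of x])
  have nn: "0 \<le> m / 2 * (dist (F x) u)\<^sup>2" "0 \<le> c / 2 * (dist x y)\<^sup>2"
    using m \<open>0 < c\<close> by auto
  have "m / 2 * (dist (F x) u)\<^sup>2 < f y - lo + 1"
    using hx nn lo[OF x(1)] by linarith
  also have "\<dots> = m / 2 * q\<^sup>2"
    using q by (simp add: m_def)
  finally have "dist (F x) u < q"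
    using m q by (simp add: power2_less_imp_less)
  then have "x \<notin> S"
    using \<rho>(2)[of x] u q by auto
  then have fx: "f y - e < f x"
    using x(1) by (auto simp: S_def)
  show thesis
  proof
    show "0 < m" "x \<in> B" "u \<in> \<Gamma>" by fact+
    show "dist (F x) u \<le> \<eta>"
      using \<open>dist (F x) u < q\<close> q by simp
    show "m * (dist (F x) u)\<^sup>2 \<le> 2 * e" "c * (dist x y)\<^sup>2 \<le> 2 * e"
      using hx fx nn by linarith+
    show "\<forall>z\<in>B. \<forall>v\<in>\<Gamma>. f x + m / 2 * (dist (F x) u)\<^sup>2 + c / 2 * (dist x y)\<^sup>2 \<le>
      f z + m / 2 * (dist (F z) v)\<^sup>2 + c / 2 * (dist z y)\<^sup>2"
    proof (intro ballI)
      fix z v assume z: "z \<in> B" "v \<in> \<Gamma>"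
      have "h z \<le> f z + m / 2 * (dist (F z) v)\<^sup>2 + c / 2 * (dist z y)\<^sup>2"
        unfolding h_def using m infdist_le[OF z(2)] by (auto intro!: power_mono infdist_nonneg)
      then show "f x + m / 2 * (dist (F x) u)\<^sup>2 + c / 2 * (dist x y)\<^sup>2 \<le>
        f z + m / 2 * (dist (F z) v)\<^sup>2 + c / 2 * (dist z y)\<^sup>2"
        using x(2)[OF z(1)] u by (simp add: h_def)
    qed
  qed
qed

text \<open>Freezing \<open>z = x\<close> makes \<open>u\<close> a projection of \<open>F x\<close>
  onto \<open>\<Gamma>\<close>, hence the normal. Freezing \<open>v = u\<close> and expanding the
  square around \<open>F x\<close> makes \<open>x\<close> a local minimizer of
  \<open>l \<bullet> F\<close> plus a differentiable function, hence the subgradient.\<close>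

lemma penalty_minimizer_stationary:
  fixes f :: "'a::euclidean_space \<Rightarrow> real" and F :: "'a \<Rightarrow> 'b::euclidean_space"
  assumes f: "f differentiable (at x)" and F: "L-lipschitz_on B F" and x: "x \<in> interior B"
    and "u \<in> \<Gamma>" and m: "0 < m"
    and min: "\<And>z v. z \<in> B \<Longrightarrow> v \<in> \<Gamma> \<Longrightarrow>
      f x + m / 2 * (dist (F x) u)\<^sup>2 + c / 2 * (dist x y)\<^sup>2 \<le>
      f z + m / 2 * (dist (F z) v)\<^sup>2 + c / 2 * (dist z y)\<^sup>2"
  defines "l \<equiv> m *\<^sub>R (F x - u)"
  shows "l \<in> limiting_normal_cone \<Gamma> u"
    and "- (c *\<^sub>R (x - y)) - gradient f x \<in> limiting_subdifferential (\<lambda>z. l \<bullet> F z) x"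
proof -
  have xB: "x \<in> B" using x interior_subset by blast
  have "dist (F x) u \<le> dist (F x) v" if "v \<in> \<Gamma>" for v
  proof (rule power2_le_imp_le)
    have "m / 2 * (dist (F x) u)\<^sup>2 \<le> m / 2 * (dist (F x) v)\<^sup>2"
      using min[OF xB that] by linarith
    then show "(dist (F x) u)\<^sup>2 \<le> (dist (F x) v)\<^sup>2"
      using m by simp
  qed simp
  then show "l \<in> limiting_normal_cone \<Gamma> u"
    unfolding l_def using m \<open>u \<in> \<Gamma>\<close> by (intro projection_normal) auto
  text \<open>The term \<open>K * |z - x|\<^sup>2\<close> dominates the remainder \<open>m / 2 * |F z - F x|\<^sup>2\<close> of the
    penalty, so \<open>F\<close> enters only through \<open>l \<bullet> F\<close> and no chain rule is needed.\<close>
  define K where "K = m / 2 * L\<^sup>2"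
  define g where "g z = f z + c / 2 * ((z - y) \<bullet> (z - y)) + K * ((z - x) \<bullet> (z - x))" for z
  have "(f has_derivative (\<lambda>h. h \<bullet> gradient f x)) (at x)"
    using gderiv_gradient[OF f] by (simp add: gderiv_def)
  then have "(g has_derivative (\<lambda>h. h \<bullet> (gradient f x + c *\<^sub>R (x - y)))) (at x)"
    unfolding g_def
    by (auto intro!: derivative_eq_intros simp: fun_eq_iff inner_commute inner_add_right algebra_simps)
  then have "GDERIV g x :> gradient f x + c *\<^sub>R (x - y)"
    by (simp add: gderiv_def)
  moreover have "\<forall>\<^sub>F z in nhds x. l \<bullet> F x + g x \<le> l \<bullet> F z + g z"
    using eventually_nhds_in_open[OF open_interior x]
  proof eventually_elim
    case (elim z)
    then have zB: "z \<in> B" using interior_subset by blast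
    have "(norm (F z - F x))\<^sup>2 \<le> (L * norm (z - x))\<^sup>2"
      using lipschitz_onD[OF F zB xB] by (intro power_mono) (auto simp: dist_norm)
    then have lip: "m / 2 * (norm (F z - F x))\<^sup>2 \<le> K * ((z - x) \<bullet> (z - x))"
      using m by (simp add: K_def power_mult_distrib power2_norm_eq_inner)
    have sq: "(dist (F z) u)\<^sup>2 = (dist (F x) u)\<^sup>2 + 2 * ((F x - u) \<bullet> (F z - F x)) + (norm (F z - F x))\<^sup>2"
      by (simp add: dist_norm power2_norm_eq_inner inner_diff_left inner_diff_right inner_commute)
    have "l \<bullet> F z - l \<bullet> F x = m * ((F x - u) \<bullet> (F z - F x))"
      by (simp add: l_def inner_diff_right right_diff_distrib)
    then have pen: "m / 2 * (dist (F z) u)\<^sup>2 =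
        m / 2 * (dist (F x) u)\<^sup>2 + (l \<bullet> F z - l \<bullet> F x) + m / 2 * (norm (F z - F x))\<^sup>2"
      unfolding sq by (simp add: distrib_left)
    have norms: "(v - w) \<bullet> (v - w) = (dist v w)\<^sup>2" for v w :: 'a
      by (simp add: dist_norm power2_norm_eq_inner)
    have "l \<bullet> F x + (f x + c / 2 * (dist x y)\<^sup>2) \<le> l \<bullet> F z + g z"
      using min[OF zB \<open>u \<in> \<Gamma>\<close>] lip pen unfolding g_def norms by linarith
    then show ?case
      by (simp add: g_def[of x] norms)
  qed
  ultimately have "- (gradient f x + c *\<^sub>R (x - y)) \<in> limiting_subdifferential (\<lambda>z. l \<bullet> F z) x"
    by (rule limiting_subdifferential_of_local_min)
  then show "- (c *\<^sub>R (x - y)) - gradient f x \<in> limiting_subdifferential (\<lambda>z. l \<bullet> F z) x"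
    by (simp only: minus_add add_uminus_conv_diff)
qed

text \<open>The competitor \<open>(z, F z)\<close> has no infeasibility penalty, and its other terms
  exceed those at \<open>x\<close> by at most a multiple of \<open>dist (F x) u\<close>. Dividing by
  this distance bounds the multiplier independently of \<open>m\<close> and
  \<open>c\<close>.\<close>

lemma penalty_multiplier_bound:
  fixes f :: "'a::euclidean_space \<Rightarrow> real" and F :: "'a \<Rightarrow> 'b::euclidean_space"
  assumes f: "M-lipschitz_on B f" and x: "x \<in> B" and "0 < c" "0 < \<kappa>"
    and min: "\<And>z v. z \<in> B \<Longrightarrow> v \<in> \<Gamma> \<Longrightarrow>
      f x + m / 2 * (dist (F x) u)\<^sup>2 + c / 2 * (dist x y)\<^sup>2 \<le>
      f z + m / 2 * (dist (F z) v)\<^sup>2 + c / 2 * (dist z y)\<^sup>2"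
    and z: "z \<in> B" "F z \<in> \<Gamma>" "dist x z \<le> \<kappa> * dist (F x) u"
    and bd: "c * dist x y \<le> 1" "c * dist (F x) u \<le> 1"
  shows "m * dist (F x) u \<le> 2 * M * \<kappa> + 2 * \<kappa> + \<kappa>\<^sup>2"
proof (cases "F x = u")
  case True
  then show ?thesis
    using lipschitz_on_nonneg[OF f] \<open>0 < \<kappa>\<close> by simp
next
  case False
  define p where "p = dist (F x) u"
  have p: "0 < p" using False by (simp add: p_def)
  have M: "0 \<le> M" using lipschitz_on_nonneg[OF f] .
  have fz: "f z - f x \<le> M * (\<kappa> * p)"
    using lipschitz_onD[OF f z(1) x] mult_left_mono[OF z(3) M]
    by (simp add: dist_real_def dist_commute p_def)
  have "(dist z y)\<^sup>2 \<le> (dist x y + \<kappa> * p)\<^sup>2"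
    using dist_triangle[of z y x] z(3) by (intro power_mono) (auto simp: dist_commute p_def)
  then have "c / 2 * (dist z y)\<^sup>2 \<le> c / 2 * (dist x y + \<kappa> * p)\<^sup>2"
    using \<open>0 < c\<close> by simp
  \<comment> \<open>Grouped so that \<open>bd\<close> absorbs the factor \<open>c\<close> and only
    multiples of \<open>p\<close> remain.\<close>
  also have "\<dots> = c / 2 * (dist x y)\<^sup>2 + (c * dist x y) * (\<kappa> * p) + (c * p) * (\<kappa>\<^sup>2 * p) / 2"
    by (simp add: power2_eq_square algebra_simps)
  also have "\<dots> \<le> c / 2 * (dist x y)\<^sup>2 + 1 * (\<kappa> * p) + 1 * (\<kappa>\<^sup>2 * p) / 2"
    using bd p \<open>0 < \<kappa>\<close> by (intro add_mono mult_right_mono divide_right_mono) (auto simp: p_def)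
  finally have "m / 2 * p\<^sup>2 \<le> M * (\<kappa> * p) + \<kappa> * p + \<kappa>\<^sup>2 * p / 2"
    using min[OF z(1,2)] fz by (simp add: p_def)
  then have "p * (m * p) \<le> p * (2 * M * \<kappa> + 2 * \<kappa> + \<kappa>\<^sup>2)"
    by (simp add: power2_eq_square algebra_simps)
  then show ?thesis
    using p by (simp add: p_def)
qed

theorem theorem3p18:
  fixes f :: "real ^ 'n \<Rightarrow> real"
    and F :: "real ^ 'n \<Rightarrow> real ^ 'l"
    and \<Gamma> :: "(real ^ 'l) set"
    and xbar d :: "real ^ 'n"
  assumes "continuously_differentiable f"
    and "directionally_differentiable F"
    and "locally_lipschitz F"
    and "\<Gamma> \<noteq> {}"
    and "closed \<Gamma>"
    and "local_minimizer f F \<Gamma> xbar"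
    and "d \<in> implicit_critical_cone f F \<Gamma> xbar \<inter> sphere 0 1"
  shows "\<exists>x lam \<delta> \<epsilon>.
           AM_stationary_seq_dir f F \<Gamma> xbar d x lam \<delta> \<epsilon> \<and>
           (\<lambda>k. norm (\<delta> k) * norm (lam k) / norm (x k - xbar)) \<longlonglongrightarrow> 0 \<and>
           (MSCQ_dir F \<Gamma> xbar d \<longrightarrow> bounded (range lam))"
proof -

  \<comment> \<open>A common ball for local optimality and Lipschitz estimates\<close>
  have normd: "norm d = 1" and dT: "d \<in> tangent_cone (F -` \<Gamma>) xbar"
    and fd: "frechet_derivative f (at xbar) d \<le> 0"
    using assms(7) by (auto simp: implicit_critical_cone_def)
  have diff: "f differentiable (at x)" for x
    using assms(1) by (simp add: continuously_differentiable_def)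
  have contF: "continuous_on UNIV F"
  proof (clarsimp simp: continuous_on_eq_continuous_at)
    fix x
    obtain r L where "r > 0" "L-lipschitz_on (cball x r) F"
      using assms(3) unfolding locally_lipschitz_def by blast
    then show "isCont F x"
      using lipschitz_on_continuous_on continuous_on_interior[of "cball x r" F x] by auto
  qed
  obtain r0 where r0: "0 < r0" "\<And>x. x \<in> cball xbar r0 \<Longrightarrow> F x \<in> \<Gamma> \<Longrightarrow> f xbar \<le> f x"
    and Fxbar: "F xbar \<in> \<Gamma>"
    using assms(6) unfolding local_minimizer_def by blast
  obtain r1 L where r1: "0 < r1" "L-lipschitz_on (cball xbar r1) F"
    using assms(3) unfolding locally_lipschitz_def by blast
  define r where "r = min r0 r1"
  define B where "B = cball xbar r"
  have r: "0 < r" using r0 r1 by (simp add: r_def)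
  have FB: "L-lipschitz_on B F"
    using r1(2) by (rule lipschitz_on_subset) (auto simp: B_def r_def)
  have fB: "f xbar \<le> f x" if "x \<in> B" "F x \<in> \<Gamma>" for x
    using that r0 by (auto simp: B_def r_def)
  obtain M where M: "M-lipschitz_on B f"
    by (rule continuously_differentiable_lipschitz_on[OF assms(1), of B]) (simp_all add: B_def)

  \<comment> \<open>Feasible points approaching along \<open>d\<close>\<close>
  obtain W0 t0 where W0: "W0 \<longlonglongrightarrow> d" and t0: "\<And>k::nat. 0 < t0 k" "t0 \<longlonglongrightarrow> (0::real)"
    and y0: "\<And>k. F (xbar + t0 k *\<^sub>R W0 k) \<in> \<Gamma>"
    using dT unfolding tangent_cone_def by auto
  have "(\<lambda>k. xbar + t0 k *\<^sub>R W0 k) \<longlonglongrightarrow> xbar + 0 *\<^sub>R d"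
    by (intro tendsto_intros t0 W0)
  then have "\<forall>\<^sub>F k in sequentially. dist (xbar + t0 k *\<^sub>R W0 k) xbar < r"
    using r by (auto dest: tendstoD)
  then obtain N0 where N0: "\<And>k. k \<ge> N0 \<Longrightarrow> dist (xbar + t0 k *\<^sub>R W0 k) xbar < r"
    by (auto simp: eventually_sequentially)
  define W where "W k = W0 (k + N0)" for k
  define t where "t k = t0 (k + N0)" for k
  define y where "y k = xbar + t k *\<^sub>R W k" for k
  have W: "W \<longlonglongrightarrow> d" and t: "\<And>k. 0 < t k" "t \<longlonglongrightarrow> 0"
    using LIMSEQ_ignore_initial_segment[OF W0] LIMSEQ_ignore_initial_segment[OF t0(2)] t0(1)
    by (simp_all add: W_def[abs_def] t_def[abs_def])
  have yB: "y k \<in> B" and yF: "F (y k) \<in> \<Gamma>" for k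
    using N0[OF le_add2, of k] y0[of "k + N0"]
    unfolding y_def W_def t_def B_def mem_cball by (metis dist_commute less_imp_le)+
  define a where "a k = (f (y k) - f xbar) /\<^sub>R t k" for k
  have a0: "0 \<le> a k" for k
    using fB[OF yB yF] t(1)[of k] by (simp add: a_def)
  \<comment> \<open>Feasibility of \<open>y k\<close> makes the limit nonnegative, criticality of
    \<open>d\<close> makes it nonpositive.\<close>
  have "a \<longlonglongrightarrow> frechet_derivative f (at xbar) d"
    unfolding a_def y_def
    by (intro has_derivative_imp_hadamard W t) (use diff frechet_derivative_works in blast)
  moreover from this have "0 \<le> frechet_derivative f (at xbar) d"
    using a0 by (intro LIMSEQ_le_const) auto
  ultimately have a: "a \<longlonglongrightarrow> 0"
    using fd by simp
  \<comment> \<open>The extra null term makes \<open>e k\<close> positive and yields the strict gap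
    demanded by \<open>penalty_minimizer\<close>.\<close>
  define e where "e k = a k + 1 / Suc k" for k
  have e0: "0 < e k" for k
    using a0[of k] by (simp add: e_def add_nonneg_pos)
  have "e \<longlonglongrightarrow> 0 + 0"
    unfolding e_def by (intro tendsto_add a LIMSEQ_Suc lim_1_over_n)
  then have e: "e \<longlonglongrightarrow> 0" by simp
  text \<open>This scaling makes both \<open>dist (x k) (y k) / t k\<close> and \<open>c k * dist (x k) (y k)\<close> vanish.\<close>
  define s where "s k = sqrt (e k)" for k
  define c where "c k = s k / t k" for k
  have s0: "0 < s k" and se: "(s k)\<^sup>2 = e k" for k
    using e0[of k] by (auto simp: s_def less_imp_le)
  have c0: "0 < c k" for k
    using s0 t by (simp add: c_def)
  have s: "s \<longlonglongrightarrow> 0"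
    using tendsto_real_sqrt[OF e] by (simp add: s_def[abs_def])

  \<comment> \<open>Penalized minimizers and their error estimates\<close>
  \<comment> \<open>Gap and infeasibility tolerance are both \<open>t k * e k\<close>, which forces
    \<open>\<delta> k\<close> to be of smaller order than \<open>t k\<close>.\<close>
  define P where "P k m x u \<longleftrightarrow> 0 < m \<and> x \<in> B \<and> u \<in> \<Gamma> \<and>
    (\<forall>z\<in>B. \<forall>v\<in>\<Gamma>.
      f x + m / 2 * (dist (F x) u)\<^sup>2 + c k / 2 * (dist x (y k))\<^sup>2 \<le>
      f z + m / 2 * (dist (F z) v)\<^sup>2 + c k / 2 * (dist z (y k))\<^sup>2) \<and>
    dist (F x) u \<le> t k * e k \<and> m * (dist (F x) u)\<^sup>2 \<le> 2 * (t k * e k) \<and>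
    c k * (dist x (y k))\<^sup>2 \<le> 2 * (t k * e k)" for k m x u
  have "\<exists>m x u. P k m x u" for k
  proof -
    have "f (y k) - f xbar = t k * a k"
      using t(1)[of k] by (simp add: a_def)
    also have "\<dots> < t k * e k"
      using t(1)[of k] by (simp add: e_def)
    finally have *: "f (y k) - t k * e k < f z" if "z \<in> B" "F z \<in> \<Gamma>" for z
      using fB[OF that] by simp
    have te: "0 < t k * e k" using t(1) e0 by simp
    show ?thesis
    proof (rule penalty_minimizer[of B f F \<Gamma> "y k" "t k * e k" "c k" "t k * e k",
          OF _ lipschitz_on_continuous_on[OF M] lipschitz_on_continuous_on[OF FB] assms(5) yB yF * c0 te])
      show "compact B" by (simp add: B_def)
    qed (assumption | (unfold P_def, intro exI conjI))+
  qed
  then obtain m x u where P: "\<And>k. P k (m k) (x k) (u k)"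
    by metis
  have m: "0 < m k" and xB: "x k \<in> B" and u: "u k \<in> \<Gamma>" for k
    using P[of k] unfolding P_def by blast+
  have min: "f (x k) + m k / 2 * (dist (F (x k)) (u k))\<^sup>2 + c k / 2 * (dist (x k) (y k))\<^sup>2 \<le>
      f z + m k / 2 * (dist (F z) v)\<^sup>2 + c k / 2 * (dist z (y k))\<^sup>2"
    if "z \<in> B" "v \<in> \<Gamma>" for k z v
    using P[of k] that unfolding P_def by blast
  define \<delta> where "\<delta> k = F (x k) - u k" for k
  define lam where "lam k = m k *\<^sub>R \<delta> k" for k
  define \<epsilon> where "\<epsilon> k = - (c k *\<^sub>R (x k - y k))" for k
  have \<delta>le: "norm (\<delta> k) \<le> t k * e k" and lamle: "norm (\<delta> k) * norm (lam k) \<le> 2 * (t k * e k)"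
    and cle: "c k * (dist (x k) (y k))\<^sup>2 \<le> 2 * (t k * e k)" for k
  proof -
    have "norm (\<delta> k) * norm (lam k) = m k * (dist (F (x k)) (u k))\<^sup>2"
      using m[of k] by (simp add: \<delta>_def lam_def dist_norm power2_eq_square)
    moreover have "norm (\<delta> k) = dist (F (x k)) (u k)"
      by (simp add: \<delta>_def dist_norm)
    ultimately show "norm (\<delta> k) \<le> t k * e k" "norm (\<delta> k) * norm (lam k) \<le> 2 * (t k * e k)"
      "c k * (dist (x k) (y k))\<^sup>2 \<le> 2 * (t k * e k)"
      using P[of k] unfolding P_def by metis+
  qed
  \<comment> \<open>With \<open>c k = s k / t k\<close> and \<open>e k = (s k)\<^sup>2\<close>, one
    factor \<open>s k\<close> cancels and one survives under the root.\<close>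
  have xy: "norm (x k - y k) \<le> t k * sqrt (2 * s k)" for k
  proof -
    have "s k * (norm (x k - y k))\<^sup>2 \<le> t k * (2 * (t k * (s k)\<^sup>2))"
      using cle[of k] t(1)[of k] by (simp add: c_def se dist_norm field_simps)
    also have "\<dots> = s k * (t k * sqrt (2 * s k))\<^sup>2"
      using s0[of k] by (simp add: power_mult_distrib power2_eq_square)
    finally show ?thesis
      using s0[of k] t(1)[of k] by (auto intro: power2_le_imp_le)
  qed
  have cxy: "c k * dist (x k) (y k) \<le> s k * sqrt (2 * s k)" for k
    using mult_left_mono[OF xy[of k], of "c k"] c0[of k] t(1)[of k]
    by (simp add: c_def dist_norm)
  have ss: "(\<lambda>k. sqrt (2 * s k)) \<longlonglongrightarrow> 0"
    using tendsto_real_sqrt[OF tendsto_mult[OF tendsto_const[of 2] s]] by simp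
  have sss: "(\<lambda>k. s k * sqrt (2 * s k)) \<longlonglongrightarrow> 0"
    using tendsto_mult[OF s ss] by simp
  have \<epsilon>: "\<epsilon> \<longlonglongrightarrow> 0"
    by (rule Lim_null_comparison[OF _ sss])
      (use cxy c0 in \<open>auto simp: \<epsilon>_def dist_norm less_imp_le intro!: always_eventually\<close>)

  \<comment> \<open>Direction of approach and rates relative to the distance from
    \<open>xbar\<close>\<close>
  have tne: "t k \<noteq> 0" for k
    using t(1)[of k] by simp
  have "norm ((x k - y k) /\<^sub>R t k) \<le> sqrt (2 * s k)" for k
  proof -
    have "norm ((x k - y k) /\<^sub>R t k) = norm (x k - y k) / t k"
      using t(1)[of k] by (simp add: divide_inverse mult.commute)
    then show ?thesis
      using xy[of k] t(1)[of k] by (simp add: pos_divide_le_eq mult.commute)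
  qed
  then have "(\<lambda>k. (x k - y k) /\<^sub>R t k) \<longlonglongrightarrow> 0"
    by (intro Lim_null_comparison[OF _ ss] always_eventually allI)
  from tendsto_add[OF this W] have "(\<lambda>k. (x k - y k) /\<^sub>R t k + W k) \<longlonglongrightarrow> d"
    by simp
  moreover have "(x k - y k) /\<^sub>R t k + W k = (x k - xbar) /\<^sub>R t k" for k
    using tne[of k] by (simp add: y_def scaleR_diff_right scaleR_add_right)
  ultimately have q: "(\<lambda>k. (x k - xbar) /\<^sub>R t k) \<longlonglongrightarrow> d"
    by simp
  define n where "n k = norm (x k - xbar)" for k
  have "norm ((x k - xbar) /\<^sub>R t k) = n k / t k" for k
    using t(1)[of k] by (simp add: n_def divide_inverse mult.commute)
  \<comment> \<open>As \<open>d\<close> is a unit vector, rates in \<open>t k\<close> and in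
    \<open>n k\<close> become interchangeable.\<close>
  then have nt: "(\<lambda>k. n k / t k) \<longlonglongrightarrow> 1"
    using tendsto_norm[OF q] normd by simp
  have "t k *\<^sub>R ((x k - xbar) /\<^sub>R t k) = x k - xbar" for k
    using tne[of k] by simp
  then have "(\<lambda>k. x k - xbar) \<longlonglongrightarrow> 0"
    using tendsto_scaleR[OF t(2) q] by simp
  then have xx: "x \<longlonglongrightarrow> xbar"
    by (simp add: LIM_zero_iff)
  \<comment> \<open>Holds also for \<open>n k = 0\<close> because \<open>inverse 0 = 0\<close>; such
    indices are discarded only at the end.\<close>
  have n_t: "inverse (n k / t k) *\<^sub>R ((x k - xbar) /\<^sub>R t k) = (x k - xbar) /\<^sub>R n k" for k
    using tne[of k] by (simp add: inverse_eq_divide)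
  have xdir: "(\<lambda>k. (x k - xbar) /\<^sub>R n k) \<longlonglongrightarrow> d"
    using tendsto_scaleR[OF tendsto_inverse[OF nt] q] unfolding n_t by simp
  have en: "(\<lambda>k. 2 * e k / (n k / t k)) \<longlonglongrightarrow> 0"
    using tendsto_divide[OF tendsto_mult[OF tendsto_const[of 2] e] nt] by simp
  have prod: "(\<lambda>k. norm (\<delta> k) * norm (lam k) / n k) \<longlonglongrightarrow> 0"
  proof (rule Lim_null_comparison[OF _ en], intro always_eventually allI)
    fix k
    show "norm (norm (\<delta> k) * norm (lam k) / n k) \<le> 2 * e k / (n k / t k)"
      using divide_right_mono[OF lamle, of "n k" k] by (simp add: n_def mult_ac)
  qed
  have \<delta>n: "(\<lambda>k. \<delta> k /\<^sub>R n k) \<longlonglongrightarrow> 0"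
  proof (rule Lim_null_comparison[OF _ en], intro always_eventually allI)
    fix k
    have "norm (\<delta> k) \<le> 2 * (t k * e k)"
      using \<delta>le[of k] t(1)[of k] e0[of k] mult_pos_pos[of "t k" "e k"] by linarith
    then show "norm (\<delta> k /\<^sub>R n k) \<le> 2 * e k / (n k / t k)"
      using divide_right_mono[of "norm (\<delta> k)" "2 * (t k * e k)" "n k"]
      by (simp add: n_def divide_inverse mult_ac)
  qed
  have te: "(\<lambda>k. t k * e k) \<longlonglongrightarrow> 0"
    using tendsto_mult[OF t(2) e] by simp
  have \<delta>: "\<delta> \<longlonglongrightarrow> 0"
    by (rule Lim_null_comparison[OF _ te]) (use \<delta>le in auto)
  have "\<forall>\<^sub>F k in sequentially. 0 < n k / t k"
    using nt by (rule order_tendstoD) simp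
  then have evn: "\<forall>\<^sub>F k in sequentially. x k \<noteq> xbar"
    by eventually_elim (auto simp: n_def)
  have evr: "\<forall>\<^sub>F k in sequentially. dist (x k) xbar < r"
    using xx r by (rule tendstoD)

  \<comment> \<open>Bounded multipliers under directional subregularity\<close>
  have evlam: "\<exists>C. \<forall>\<^sub>F k in sequentially. norm (lam k) \<le> C" if MSCQ: "MSCQ_dir F \<Gamma> xbar d"
  proof -
    obtain \<epsilon>' \<delta>' \<kappa> where pos: "0 < \<epsilon>'" "0 < \<delta>'" "0 < \<kappa>"
      and ms: "\<And>h. h \<in> directional_nbhd \<epsilon>' \<delta>' d \<Longrightarrow>
        infdist (xbar + h) (F -` \<Gamma>) \<le> \<kappa> * infdist (F (xbar + h)) \<Gamma>"
      using MSCQ unfolding MSCQ_dir_def by blast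
    have clX: "closed (F -` \<Gamma>)"
      using continuous_closed_vimage[OF assms(5)] contF by (auto simp: continuous_on_eq_continuous_at)
    have e1: "\<forall>\<^sub>F k in sequentially. dist (x k) xbar < \<epsilon>'"
      using xx pos(1) by (rule tendstoD)
    have e2: "\<forall>\<^sub>F k in sequentially. dist ((x k - xbar) /\<^sub>R n k) d < \<delta>'"
      using xdir pos(2) by (rule tendstoD)
    have e3: "\<forall>\<^sub>F k in sequentially. s k * sqrt (2 * s k) < 1"
      using sss by (rule order_tendstoD) simp
    have "(\<lambda>k. dist (x k) xbar + \<kappa> * norm (\<delta> k)) \<longlonglongrightarrow> dist xbar xbar + \<kappa> * norm (0 :: real ^ 'l)"
      by (intro tendsto_intros xx \<delta>)
    then have e4: "\<forall>\<^sub>F k in sequentially. dist (x k) xbar + \<kappa> * norm (\<delta> k) < r"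
      using r by (intro order_tendstoD) auto
    have "(\<lambda>k. s k * e k) \<longlonglongrightarrow> 0 * 0"
      by (intro tendsto_intros s e)
    then have e5: "\<forall>\<^sub>F k in sequentially. s k * e k < 1"
      by (intro order_tendstoD) auto
    \<comment> \<open>\<open>e1\<close> and \<open>e2\<close> place \<open>x k - xbar\<close> in the
      directional neighbourhood, \<open>e4\<close> keeps the nearby feasible point inside
      \<open>B\<close>, and \<open>e3\<close> and \<open>e5\<close> give the two bounds
      \<open>bd\<close>.\<close>
    have "\<forall>\<^sub>F k in sequentially. norm (lam k) \<le> 2 * M * \<kappa> + 2 * \<kappa> + \<kappa>\<^sup>2"
      using e1 e2 e3 e4 e5 evn
    proof eventually_elim
      case (elim k)
      have n0: "0 < n k" using elim(6) by (simp add: n_def)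
      \<comment> \<open>For a unit vector \<open>d\<close>, membership in the directional
        neighbourhood amounts to closeness of the normalized step to \<open>d\<close>.\<close>
      have "norm (norm d *\<^sub>R (x k - xbar) - norm (x k - xbar) *\<^sub>R d)
          = norm (n k *\<^sub>R ((x k - xbar) /\<^sub>R n k - d))"
        using n0 normd by (simp add: n_def scaleR_diff_right)
      also have "\<dots> \<le> \<delta>' * n k * norm d"
        using elim(2) n0 normd by (simp add: dist_norm mult.commute)
      finally have "x k - xbar \<in> directional_nbhd \<epsilon>' \<delta>' d"
        using elim(1) by (simp add: directional_nbhd_def dist_norm n_def)
      from ms[OF this] have "infdist (x k) (F -` \<Gamma>) \<le> \<kappa> * infdist (F (x k)) \<Gamma>"
        by simp
      also have "\<dots> \<le> \<kappa> * dist (F (x k)) (u k)"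
        using pos(3) infdist_le[OF u] by simp
      finally have dX: "infdist (x k) (F -` \<Gamma>) \<le> \<kappa> * dist (F (x k)) (u k)" .
      have "F -` \<Gamma> \<noteq> {}"
        using Fxbar by blast
      from infdist_attains_inf[OF clX this, of "x k"]
      obtain z where "z \<in> F -` \<Gamma>" "infdist (x k) (F -` \<Gamma>) = dist (x k) z" .
      then have z: "F z \<in> \<Gamma>" "dist (x k) z \<le> \<kappa> * dist (F (x k)) (u k)"
        using dX by simp_all
      have "dist z xbar \<le> dist (x k) xbar + \<kappa> * norm (\<delta> k)"
        using z(2) dist_triangle3[of z xbar "x k"] unfolding \<delta>_def dist_norm[symmetric] by linarith
      then have zB: "z \<in> B"
        using elim(4) by (simp add: B_def dist_commute)
      have "c k * norm (\<delta> k) \<le> c k * (t k * e k)"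
        using \<delta>le[of k] c0[of k] by simp
      also have "\<dots> = s k * e k"
        using t(1)[of k] by (simp add: c_def)
      finally have "c k * dist (F (x k)) (u k) \<le> 1"
        using elim(5) by (simp add: \<delta>_def dist_norm)
      from penalty_multiplier_bound[where F = F and \<Gamma> = \<Gamma> and u = "u k", OF M xB c0 pos(3) min zB z _ this]
      show ?case
        using cxy[of k] elim(3) m[of k] by (simp add: lam_def \<delta>_def dist_norm)
    qed
    then show ?thesis ..
  qed

  \<comment> \<open>Passing to a tail and assembling the sequence\<close>
  \<comment> \<open>Beyond \<open>N\<close> the quotients by the distance are genuine and
    \<open>x k\<close> is interior to \<open>B\<close>, as the stationarity conditions
    require.\<close>
  obtain N where N: "\<And>k. k \<ge> N \<Longrightarrow> x k \<noteq> xbar \<and> dist (x k) xbar < r"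
    using eventually_conj[OF evn evr] by (auto simp: eventually_sequentially)
  have stat: "lam k \<in> limiting_normal_cone \<Gamma> (F (x k) - \<delta> k)"
    "\<epsilon> k - gradient f (x k) \<in> limiting_subdifferential (\<lambda>z. lam k \<bullet> F z) (x k)" if "k \<ge> N" for k
  proof -
    have "x k \<in> interior B"
      using N[OF that] unfolding B_def interior_cball mem_ball by (metis dist_commute)
    from penalty_minimizer_stationary[where F = F and \<Gamma> = \<Gamma> and u = "u k", OF diff FB this u m min]
    show "lam k \<in> limiting_normal_cone \<Gamma> (F (x k) - \<delta> k)"
      "\<epsilon> k - gradient f (x k) \<in> limiting_subdifferential (\<lambda>z. lam k \<bullet> F z) (x k)"
      by (simp_all add: lam_def \<delta>_def \<epsilon>_def)
  qed
  \<comment> \<open>\<open>lam k\<close> is a positive multiple of \<open>\<delta> k\<close>, so the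
    alignment condition holds exactly, with null sequence constantly zero.\<close>
  have align: "norm (\<delta> k) *\<^sub>R lam k - norm (lam k) *\<^sub>R \<delta> k = 0" for k
    using m[of k] by (simp add: lam_def)
  note shift = LIMSEQ_ignore_initial_segment[where k = N]
  have "AM_stationary_seq_dir f F \<Gamma> xbar d (\<lambda>k. x (k + N)) (\<lambda>k. lam (k + N))
      (\<lambda>k. \<delta> (k + N)) (\<lambda>k. \<epsilon> (k + N))"
    unfolding AM_stationary_seq_dir_def AM_stationary_seq_def
  proof (intro conjI allI)
    show "d \<in> linearization_cone F \<Gamma> xbar \<inter> sphere 0 1"
      using dT normd tangent_cone_subset_linearization_cone[OF assms(2,3)] by auto
    show "seq_little_o
        (\<lambda>k. norm (\<delta> (k + N)) *\<^sub>R lam (k + N) - norm (lam (k + N)) *\<^sub>R \<delta> (k + N))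
        (\<lambda>k. norm (\<delta> (k + N)) * norm (lam (k + N)))"
      unfolding seq_little_o_def by (intro exI[of _ "\<lambda>_. 0"]) (simp add: align)
    show "bounded (range (\<lambda>k. norm (\<delta> (k + N)) * norm (lam (k + N)) / norm (x (k + N) - xbar)))"
      using shift[OF prod] unfolding n_def by (rule convergent_imp_bounded)
  qed (use Fxbar stat N shift[OF xx] shift[OF \<delta>] shift[OF \<epsilon>] shift[OF xdir] shift[OF \<delta>n] in
      \<open>auto simp: n_def\<close>)
  moreover have "bounded (range (\<lambda>k. lam (k + N)))" if "MSCQ_dir F \<Gamma> xbar d"
  proof -
    obtain C where "\<forall>\<^sub>F k in sequentially. norm (lam k) \<le> C"
      using evlam[OF \<open>MSCQ_dir F \<Gamma> xbar d\<close>] ..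
    then have "bounded (range lam)"
      by (metis BfunI Bseq_eq_bounded)
    then show ?thesis
      by (rule bounded_subset) auto
  qed
  ultimately show ?thesis
    using shift[OF prod] unfolding n_def by blast
qed

end
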